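(* Let $\mathcal{H}$ be a complex Hilbert space, let $A\in\mathcal{B}(\mathcal{H})$ be a positive operator, and let $T\in\mathcal{B}_A(\mathcal{H})$. Then $$w_A(T)\geq\sqrt{\frac{\|T^{\sharp_A}T+TT^{\sharp_A}\|_A}{4}+\frac{\big|\,\|\Re_A(T)+\Im_A(T)\|_A^2-\|\Re_A(T)-\Im_A(T)\|_A^2\,\big|}{4}}.$$
   Context: $\mathcal{B}(\mathcal{H})$ is the algebra of bounded linear operators on the complex Hilbert space $\mathcal{H}$ with inner product $\langle\cdot,\cdot\rangle$; $A\in\mathcal{B}(\mathcal{H})$ is positive (i.e. $\langle Ax,x\rangle\ge 0$ for all $x$), not necessarily injective. Put $\langle x,y\rangle_A=\langle Ax,y\rangle$ and $\|x\|_A=\sqrt{\langle x,x\rangle_A}$ (a seminorm on $\mathcal{H}$). $R(S)$ denotes the range of $S$ and $\overline{R(S)}$ its norm closure. $\mathcal{B}_A(\mathcal{H})=\{T\in\mathcal{B}(\mathcal{H}): R(T^*A)\subseteq R(A)\}$, equivalently the set of $T\in\mathcal{B}(\mathcal{H})$ for which there is $S\in\mathcal{B}(\mathcal{H})$ with $AS=T^*A$. For $T\in\mathcal{B}_A(\mathcal{H})$, $T^{\sharp_A}$ denotes the unique $X\in\mathcal{B}(\mathcal{H})$ with $AX=T^*A$ and $R(X)\subseteq\overline{R(A)}$. For $T\in\mathcal{B}_A(\mathcal{H})$: $\|T\|_A=\sup\{\|Tx\|_A: x\in\overline{R(A)},\ \|x\|_A=1\}=\sup\{\|Tx\|_A: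 x\in\mathcal{H},\ \|x\|_A=1\}$ (finite), and $w_A(T)=\sup\{|\langle Tx,x\rangle_A|: x\in\mathcal{H},\ \|x\|_A=1\}$. Finally $\Re_A(T)=\frac{T+T^{\sharp_A}}{2}$ and $\Im_A(T)=\frac{T-T^{\sharp_A}}{2\mathrm{i}}$. *)

theory Defs
  imports "HOL-Analysis.Analysis"
begin

text \<open>
  Complex inner product spaces, linear in the first argument. They are built on top of
  \<^class>\<open>real_inner\<close>, which supplies the norm and the topology; the axiom \<open>inner_eq_Re_cinner\<close>
  ties its inner product to the complex one, so that \<open>cinner x x = (norm x)\<^sup>2\<close>.
\<close>

class complex_inner = real_inner +
  fixes scaleC :: "complex \<Rightarrow> 'a \<Rightarrow> 'a"  (infixr "*\<^sub>C" 75)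
    and cinner :: "'a \<Rightarrow> 'a \<Rightarrow> complex"
  assumes scaleC_add_right: "c *\<^sub>C (x + y) = c *\<^sub>C x + c *\<^sub>C y"
    and scaleC_add_left: "(c + d) *\<^sub>C x = c *\<^sub>C x + d *\<^sub>C x"
    and scaleC_scaleC: "c *\<^sub>C (d *\<^sub>C x) = (c * d) *\<^sub>C x"
    and scaleR_eq_scaleC: "r *\<^sub>R x = complex_of_real r *\<^sub>C x"
    and cinner_commute: "cinner x y = cnj (cinner y x)"
    and cinner_add_left: "cinner (x + y) z = cinner x z + cinner y z"
    and cinner_scaleC_left: "cinner (c *\<^sub>C x) y = c * cinner x y"
    and inner_eq_Re_cinner: "inner x y = Re (cinner x y)"

class complex_hilbert = complex_inner + complete_space

definition bounded_op :: "('a::complex_hilbert \<Rightarrow> 'a) \<Rightarrow> bool" where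
  "bounded_op T \<longleftrightarrow> bounded_linear T \<and> (\<forall>c x. T (c *\<^sub>C x) = c *\<^sub>C T x)"

definition positive_op :: "('a::complex_hilbert \<Rightarrow> 'a) \<Rightarrow> bool" where
  "positive_op A \<longleftrightarrow> bounded_op A \<and> (\<forall>x. cinner (A x) x \<in> \<real>\<^sub>\<ge>\<^sub>0)"

definition adj :: "('a::complex_hilbert \<Rightarrow> 'a) \<Rightarrow> 'a \<Rightarrow> 'a" where
  "adj T = (THE S. bounded_op S \<and> (\<forall>x y. cinner (T x) y = cinner x (S y)))"

definition cinner_A :: "('a::complex_hilbert \<Rightarrow> 'a) \<Rightarrow> 'a \<Rightarrow> 'a \<Rightarrow> complex" where
  "cinner_A A x y = cinner (A x) y"

definition norm_A :: "('a::complex_hilbert \<Rightarrow> 'a) \<Rightarrow> 'a \<Rightarrow> real" where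
  "norm_A A x = sqrt (Re (cinner_A A x x))"

definition ops_A :: "('a::complex_hilbert \<Rightarrow> 'a) \<Rightarrow> ('a \<Rightarrow> 'a) set" where
  "ops_A A = {T. bounded_op T \<and> range (adj T \<circ> A) \<subseteq> range A}"

definition sharp_A :: "('a::complex_hilbert \<Rightarrow> 'a) \<Rightarrow> ('a \<Rightarrow> 'a) \<Rightarrow> 'a \<Rightarrow> 'a" where
  "sharp_A A T = (THE X. bounded_op X \<and> A \<circ> X = adj T \<circ> A \<and> range X \<subseteq> closure (range A))"

text \<open>
  Suprema of sets of nonnegative reals, taken in \<open>[0, \<infinity>)\<close>, so that the empty set has supremum 0.
  (In HOL the value of \<^const>\<open>Sup\<close> on the empty set of reals is unspecified.) The empty set
  occurs below exactly if \<open>A = 0\<close>.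
\<close>

definition nonneg_Sup :: "real set \<Rightarrow> real" where
  "nonneg_Sup S = (if S = {} then 0 else Sup S)"

definition opnorm_A :: "('a::complex_hilbert \<Rightarrow> 'a) \<Rightarrow> ('a \<Rightarrow> 'a) \<Rightarrow> real" where
  "opnorm_A A T = nonneg_Sup {norm_A A (T x) |x. x \<in> closure (range A) \<and> norm_A A x = 1}"

definition numrad_A :: "('a::complex_hilbert \<Rightarrow> 'a) \<Rightarrow> ('a \<Rightarrow> 'a) \<Rightarrow> real" where
  "numrad_A A T = nonneg_Sup {cmod (cinner_A A (T x) x) |x. norm_A A x = 1}"

definition Re_A :: "('a::complex_hilbert \<Rightarrow> 'a) \<Rightarrow> ('a \<Rightarrow> 'a) \<Rightarrow> 'a \<Rightarrow> 'a" where
  "Re_A A T = (\<lambda>x. (1 / 2) *\<^sub>C (T x + sharp_A A T x))"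

definition Im_A :: "('a::complex_hilbert \<Rightarrow> 'a) \<Rightarrow> ('a \<Rightarrow> 'a) \<Rightarrow> 'a \<Rightarrow> 'a" where
  "Im_A A T = (\<lambda>x. (1 / (2 * \<i>)) *\<^sub>C (T x - sharp_A A T x))"

end

theory Submission
  imports Defs
begin

text \<open>
  Write \<open>P = \<Re>\<^sub>A(T) + \<Im>\<^sub>A(T)\<close> and \<open>M = \<Re>\<^sub>A(T) - \<Im>\<^sub>A(T)\<close>. Both are symmetric for the
  form of \<open>A\<close>, and \<open>P\<^sup>2 + M\<^sup>2\<close> is \<open>T\<^sup>\<sharp>T + TT\<^sup>\<sharp>\<close>. The real and imaginary parts of the numerical
  range of \<open>T\<close> are those of \<open>\<Re>\<^sub>A(T)\<close> and \<open>\<Im>\<^sub>A(T)\<close>, so the numerical ranges of \<open>P\<close> and \<open>M\<close>, hence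
  their seminorms \<open>a\<close> and \<open>b\<close>, are at most \<open>\<surd>2\<close> times the numerical radius \<open>w\<close>. So
  \<open>2 w\<^sup>2 \<ge> max a\<^sup>2 b\<^sup>2 = (a\<^sup>2 + b\<^sup>2 + \<bar>a\<^sup>2 - b\<^sup>2\<bar>) / 2\<close>, and \<open>a\<^sup>2 + b\<^sup>2\<close> dominates the seminorm of
  \<open>P\<^sup>2 + M\<^sup>2\<close>. The adjoint and \<open>T\<^sup>\<sharp>\<close> are definite descriptions, so their existence has to be
  established: by Riesz representation and by Douglas' factorization.
\<close>

subsection \<open>Real Hilbert spaces\<close>

text \<open>Near \<open>t = 0\<close> a linear term dominates a quadratic one, so it has to vanish.
  This is the first-order condition at a point of minimal distance.\<close>

lemma linear_le_quadratic_imp_zero: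
  fixes a b :: real
  assumes "a \<ge> 0" and le: "\<And>t. 2 * t * b \<le> a * t\<^sup>2"
  shows "b = 0"
proof -
  \<comment> \<open>Dividing by \<open>a + 1\<close> instead of \<open>a\<close> covers
    \<open>a = 0\<close> as well.\<close>
  have "2 * (b / (a + 1)) * b \<le> a * (b / (a + 1))\<^sup>2" by (rule le)
  then have "2 * b\<^sup>2 * (a + 1) \<le> a * b\<^sup>2"
    using \<open>a \<ge> 0\<close> by (simp add: divide_simps power2_eq_square split: if_splits)
  then have "(a + 2) * b\<^sup>2 \<le> 0" by (simp add: algebra_simps)
  then have "b\<^sup>2 \<le> 0" using \<open>a \<ge> 0\<close> by (simp add: mult_le_0_iff)
  then show ?thesis by simp
qed

lemma parallelogram_law:
  fixes x y :: "'a::real_inner"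
  shows "(norm (x + y))\<^sup>2 + (norm (x - y))\<^sup>2 = 2 * (norm x)\<^sup>2 + 2 * (norm y)\<^sup>2"
  by (simp add: power2_norm_eq_inner algebra_simps inner_commute)

lemma closure_of_subspace:
  fixes M :: "'a::real_normed_vector set"
  assumes "subspace M"
  shows "subspace (closure M)"
proof (rule subspaceI)
  show "0 \<in> closure M"
    using subspace_0[OF assms] closure_subset by blast
next
  fix x y assume "x \<in> closure M" "y \<in> closure M"
  then obtain f g where "\<And>n. f n \<in> M" "f \<longlonglongrightarrow> x" "\<And>n. g n \<in> M" "g \<longlonglongrightarrow> y"
    by (auto simp: closure_sequential)
  then show "x + y \<in> closure M"
    unfolding closure_sequential
    by (intro exI[of _ "\<lambda>n. f n + g n"]) (auto intro: tendsto_add subspace_add[OF assms])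
next
  fix c x assume "x \<in> closure M"
  then obtain f where "\<And>n. f n \<in> M" "f \<longlonglongrightarrow> x"
    by (auto simp: closure_sequential)
  then show "c *\<^sub>R x \<in> closure M"
    unfolding closure_sequential
    by (intro exI[of _ "\<lambda>n. c *\<^sub>R f n"]) (auto intro: tendsto_scaleR subspace_scale[OF assms])
qed

text \<open>A sequence in \<open>M\<close> minimising the distance to \<open>x\<close> is Cauchy by
  the parallelogram law. Its limit is a nearest point, and varying that point along \<open>m\<close>
  gives orthogonality.\<close>

theorem orthogonal_projection_exists:
  fixes M :: "'a::{real_inner, complete_space} set"
  assumes M: "subspace M" "closed M"
  shows "\<exists>p\<in>M. \<forall>m\<in>M. inner (x - p) m = 0"
proof -
  define d where "d = (INF m\<in>M. (norm (x - m))\<^sup>2)"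
  have d_le: "d \<le> (norm (x - m))\<^sup>2" if "m \<in> M" for m
    unfolding d_def using that by (intro cINF_lower bdd_belowI2[of _ 0]) auto
  have ne: "(\<lambda>m. (norm (x - m))\<^sup>2) ` M \<noteq> {}"
    using subspace_0[OF M(1)] by auto
  have "\<exists>m\<in>M. (norm (x - m))\<^sup>2 < d + 1 / real (Suc n)" for n
    using cInf_lessD[OF ne, of "d + 1 / real (Suc n)"] by (auto simp: d_def)
  then obtain f where fM: "\<And>n. f n \<in> M"
    and f: "\<And>n. (norm (x - f n))\<^sup>2 < d + 1 / real (Suc n)"
    by metis
  have close: "(norm (f i - f j))\<^sup>2 \<le> 2 / real (Suc i) + 2 / real (Suc j)" for i j
  proof -
    \<comment> \<open>The midpoint is no closer to \<open>x\<close> than the infimum allows. This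
      bounds the sum of the two errors from below, so the parallelogram law makes their difference
      small.\<close>
    have mid: "(1 / 2) *\<^sub>R (f i + f j) \<in> M"
      by (intro subspace_scale subspace_add fM M)
    have "(x - f i) + (x - f j) = 2 *\<^sub>R (x - (1 / 2) *\<^sub>R (f i + f j))"
      by (simp add: algebra_simps scaleR_2)
    then have "(norm ((x - f i) + (x - f j)))\<^sup>2 = 4 * (norm (x - (1 / 2) *\<^sub>R (f i + f j)))\<^sup>2"
      by (simp add: power_mult_distrib)
    then have "(norm ((x - f i) + (x - f j)))\<^sup>2 \<ge> 4 * d"
      using d_le[OF mid] by linarith
    moreover have "norm ((x - f i) - (x - f j)) = norm (f i - f j)"
      by (simp add: norm_minus_commute)
    ultimately show ?thesis
      using parallelogram_law[of "x - f i" "x - f j"] f[of i] f[of j] by simp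
  qed
  have "Cauchy f"
  proof (rule metric_CauchyI)
    fix e :: real assume "e > 0"
    obtain N where N: "real N > 4 / e\<^sup>2" using reals_Archimedean2 by blast
    have "dist (f i) (f j) < e" if "i \<ge> N" "j \<ge> N" for i j
    proof -
      have "4 / e\<^sup>2 > 0" using \<open>e > 0\<close> by simp
      then have "N > 0" using N by (cases N) auto
      have "2 / real (Suc i) \<le> 2 / real (Suc N)" "2 / real (Suc j) \<le> 2 / real (Suc N)"
        using that by (intro divide_left_mono; simp)+
      moreover have "4 / real (Suc N) < e\<^sup>2"
      proof -
        have "4 < real N * e\<^sup>2" using N \<open>e > 0\<close> by (simp add: divide_less_eq)
        also have "\<dots> \<le> real (Suc N) * e\<^sup>2" by (intro mult_right_mono) auto
        finally show ?thesis by (simp add: divide_less_eq mult.commute)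
      qed
      ultimately have "(norm (f i - f j))\<^sup>2 < e\<^sup>2" using close[of i j] by simp
      then show ?thesis
        using \<open>e > 0\<close> by (simp add: dist_norm power_less_imp_less_base)
    qed
    then show "\<exists>N. \<forall>i\<ge>N. \<forall>j\<ge>N. dist (f i) (f j) < e" by blast
  qed
  then obtain p where p: "f \<longlonglongrightarrow> p"
    using Cauchy_convergent convergent_def by blast
  have pM: "p \<in> M"
    using closed_sequentially[OF M(2)] fM p by blast
  have "(\<lambda>n. d + 1 / real (Suc n)) \<longlonglongrightarrow> d + 0"
    by (intro tendsto_intros LIMSEQ_Suc[OF lim_1_over_n])
  moreover have "(\<lambda>n. (norm (x - f n))\<^sup>2) \<longlonglongrightarrow> (norm (x - p))\<^sup>2"
    by (intro tendsto_intros p)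
  ultimately have p_min: "(norm (x - p))\<^sup>2 \<le> d"
    using LIMSEQ_le f less_imp_le by (metis (no_types, lifting) add_0_right)
  have "inner (x - p) m = 0" if m: "m \<in> M" for m
  proof (rule linear_le_quadratic_imp_zero)
    fix t
    have "p + t *\<^sub>R m \<in> M" by (intro subspace_add subspace_scale M pM m)
    then have "(norm (x - p))\<^sup>2 \<le> (norm ((x - p) - t *\<^sub>R m))\<^sup>2"
      unfolding diff_diff_eq using d_le p_min order_trans by blast
    also have "\<dots> = (norm (x - p))\<^sup>2 - 2 * t * inner (x - p) m + (norm m)\<^sup>2 * t\<^sup>2"
      unfolding power2_norm_eq_inner
      by (simp add: inner_diff_left inner_diff_right inner_commute power2_eq_square)
    finally show "2 * t * inner (x - p) m \<le> (norm m)\<^sup>2 * t\<^sup>2" by simp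
  qed simp
  with pM show ?thesis by blast
qed

text \<open>The kernel of a nonzero \<open>f\<close> has a normal vector \<open>u\<close>, and
  subtracting a suitable multiple of \<open>u\<close> moves any \<open>x\<close> into the
  kernel.\<close>

theorem riesz_representation:
  fixes f :: "'a::{real_inner, complete_space} \<Rightarrow> real"
  assumes "bounded_linear f"
  shows "\<exists>z. \<forall>x. f x = inner x z"
proof (cases "\<forall>x. f x = 0")
  case True
  then show ?thesis by (intro exI[of _ 0]) simp
next
  case False
  interpret bounded_linear f by fact
  from False obtain y where y: "f y \<noteq> 0" by blast
  have "subspace (f -` {0})"
    by (auto simp: subspace_def add scale)
  moreover have "closed (f -` {0})"
    by (intro closed_vimage continuous_on_closed_vimage closed_singleton linear_continuous_on assms)
  ultimately obtain p where p: "f p = 0" and orth: "\<And>m. f m = 0 \<Longrightarrow> inner (y - p) m = 0"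
    using orthogonal_projection_exists[of "f -` {0}" y] by auto
  define u where "u = y - p"
  have fu: "f u \<noteq> 0" using y p by (simp add: u_def diff)
  then have "u \<noteq> 0" using zero by blast
  have "f x = inner x ((f u / inner u u) *\<^sub>R u)" for x
  proof -
    have "inner u (x - (f x / f u) *\<^sub>R u) = 0"
      unfolding u_def by (rule orth) (use fu in \<open>simp add: diff scale u_def\<close>)
    then have "inner u x = (f x / f u) * inner u u" by (simp add: inner_diff_right)
    then show ?thesis using fu \<open>u \<noteq> 0\<close> by (simp add: inner_commute)
  qed
  then show ?thesis by blast
qed

text \<open>Riesz representation of \<open>\<lambda>x. inner (T x) y\<close> yields
  \<open>S y\<close>; evaluating at \<open>x = S y\<close> bounds its norm.\<close>

theorem adjoint_exists:
  fixes T :: "'a::{real_inner, complete_space} \<Rightarrow> 'b::real_inner"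
  assumes "bounded_linear T"
  shows "\<exists>S. bounded_linear S \<and> (\<forall>x y. inner (T x) y = inner x (S y))"
proof -
  interpret bounded_linear T by fact
  have "\<exists>z. \<forall>x. inner (T x) y = inner x z" for y
    by (intro riesz_representation bounded_linear_inner_left_comp assms)
  then obtain S where S: "\<And>x y. inner (T x) y = inner x (S y)" by metis
  obtain K where K: "\<And>x. norm (T x) \<le> norm x * K" and "K > 0"
    using pos_bounded by blast
  have "bounded_linear S"
  proof (rule bounded_linear_intro)
    show "S (x + y) = S x + S y" for x y
      by (rule vector_eq_ldot[THEN iffD1]) (simp add: inner_add_right flip: S)
    show "S (r *\<^sub>R x) = r *\<^sub>R S x" for r x
      by (rule vector_eq_ldot[THEN iffD1]) (simp flip: S)
    show "norm (S y) \<le> norm y * K" for y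
    proof (cases "S y = 0")
      case True
      then show ?thesis using \<open>K > 0\<close> by simp
    next
      case False
      have "norm (S y) * norm (S y) = inner (T (S y)) y"
        by (simp add: S power2_norm_eq_inner flip: power2_eq_square)
      also have "\<dots> \<le> norm (S y) * K * norm y"
        by (meson K mult_right_mono norm_cauchy_schwarz norm_ge_zero order_trans)
      finally show ?thesis using False by (simp add: mult_ac)
    qed
  qed
  with S show ?thesis by blast
qed

text \<open>The uniform boundedness principle, by Baire category: the closed sets \<open>C n\<close>
  cover the space, so one of them contains a ball.\<close>

theorem weakly_bounded_imp_bounded:
  fixes V :: "'a::{real_inner, complete_space} set"
  assumes "\<And>x. bounded ((\<lambda>v. inner x v) ` V)"
  shows "bounded V"
proof -
  define C where "C n = {x. \<forall>v\<in>V. \<bar>inner x v\<bar> \<le> real n}" for n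
  have closed: "closed (C n)" for n
  proof -
    have "C n = (\<Inter>v\<in>V. {x. \<bar>inner x v\<bar> \<le> real n})" by (auto simp: C_def)
    moreover have "closed {x. \<bar>inner x v\<bar> \<le> real n}" for v :: 'a
      by (intro closed_Collect_le continuous_intros)
    ultimately show ?thesis by auto
  qed
  have cover: "(\<Union>n. C n) = UNIV"
  proof -
    have "\<exists>n. x \<in> C n" for x
    proof -
      obtain B where "\<And>v. v \<in> V \<Longrightarrow> \<bar>inner x v\<bar> \<le> B"
        using assms[of x] by (auto simp: bounded_iff)
      moreover obtain n where "B \<le> real n" using real_arch_simple by blast
      ultimately show ?thesis unfolding C_def by (smt (verit) mem_Collect_eq)
    qed
    then show ?thesis by blast
  qed
  have "\<exists>n. interior (C n) \<noteq> {}"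
  proof (rule ccontr)
    assume "\<not> ?thesis"
    then have "euclidean interior_of \<Union>(range C) = {}"
      by (intro Baire_category_alt)
        (auto simp: closed completely_metrizable_space_euclidean)
    with cover show False by simp
  qed
  then obtain n a where "a \<in> interior (C n)" by blast
  then obtain e where e: "e > 0" "ball a e \<subseteq> C n" by (auto simp: mem_interior)
  have "norm v \<le> 4 * real n / e" if v: "v \<in> V" for v
  proof (cases "v = 0")
    case False
    \<comment> \<open>A step of length \<open>e / 2\<close> along \<open>v\<close> stays in the
      ball. Comparing the values at \<open>a + h\<close> and \<open>a\<close> isolates
      \<open>inner h v\<close>, a fixed multiple of \<open>norm v\<close>.\<close>
    define h where "h = (e / (2 * norm v)) *\<^sub>R v"
    have "norm h = e / 2" using e(1) False by (simp add: h_def)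
    then have "a + h \<in> C n" "a \<in> C n" using e by (auto simp: dist_norm)
    then have "\<bar>inner (a + h) v\<bar> \<le> real n" "\<bar>inner a v\<bar> \<le> real n"
      using v by (auto simp: C_def)
    then have "inner h v \<le> 2 * real n" by (simp add: inner_add_left)
    moreover have "inner h v = e / 2 * norm v"
      using False by (simp add: h_def power2_eq_square flip: power2_norm_eq_inner)
    ultimately show ?thesis using e(1) by (simp add: field_simps)
  qed (use e in simp)
  then show ?thesis by (auto simp: bounded_iff)
qed

subsection \<open>Positive semidefinite forms\<close>

text \<open>Symmetry is an axiom because over the reals it does not follow from nonnegativity. For
  complex positive operators it is derived in \<open>positive_op_psd\<close>.\<close>

locale psd_op = bounded_linear A for A :: "'a::real_inner \<Rightarrow> 'a" +
  assumes sym: "inner (A x) y = inner x (A y)"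
    and nonneg: "inner (A x) x \<ge> 0"
begin

abbreviation form :: "'a \<Rightarrow> 'a \<Rightarrow> real" where
  "form x y \<equiv> inner (A x) y"

definition snorm :: "'a \<Rightarrow> real" where
  "snorm x = sqrt (form x x)"

lemma snorm_nonneg: "snorm x \<ge> 0"
  by (simp add: snorm_def nonneg)

lemma snorm_sq: "(snorm x)\<^sup>2 = form x x"
  by (simp add: snorm_def nonneg)

lemma form_commute: "form x y = form y x"
  by (metis sym inner_commute)

lemma snorm_scale: "snorm (c *\<^sub>R x) = \<bar>c\<bar> * snorm x"
  by (simp add: snorm_def scale real_sqrt_mult flip: mult.assoc power2_eq_square)

text \<open>Cauchy-Schwarz for a possibly degenerate form, from the nonnegativity of a quadratic
  polynomial in \<open>t\<close>.\<close>

lemma form_le: "\<bar>form x y\<bar> \<le> snorm x * snorm y"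
proof -
  have expand: "2 * t * form x y \<le> form x x + form y y * t\<^sup>2" for t
    using nonneg[of "x - t *\<^sub>R y"] form_commute[of y x]
    by (simp add: diff scale inner_diff_left inner_diff_right power2_eq_square algebra_simps)
  have "(form x y)\<^sup>2 \<le> form x x * form y y"
  proof (cases "form y y = 0")
    case True
    have "form x y = 0"
    proof (rule ccontr)
      assume "form x y \<noteq> 0"
      \<comment> \<open>The bound has become linear in \<open>t\<close>; this choice turns it into
        \<open>form x x + 1 \<le> form x x\<close>.\<close>
      then show False
        using expand[of "(form x x + 1) / (2 * form x y)"] True by simp
    qed
    then show ?thesis using True by simp
  next
    case False
    then have "form y y > 0" using nonneg[of y] by simp
    with expand[of "form x y / form y y"] show ?thesis
      by (simp add: field_simps power2_eq_square)
  qed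
  then have "\<bar>form x y\<bar>\<^sup>2 \<le> (snorm x * snorm y)\<^sup>2"
    by (simp add: power_mult_distrib snorm_sq)
  then show ?thesis
    by (rule power2_le_imp_le) (simp add: snorm_nonneg)
qed

lemma snorm_triangle: "snorm (x + y) \<le> snorm x + snorm y"
proof (rule power2_le_imp_le)
  have "(snorm (x + y))\<^sup>2 = (snorm x)\<^sup>2 + 2 * form x y + (snorm y)\<^sup>2"
    using form_commute[of x y] by (simp add: snorm_sq add inner_add_left inner_add_right)
  also have "\<dots> \<le> (snorm x + snorm y)\<^sup>2"
    using form_le[of x y] by (simp add: power2_sum)
  finally show "(snorm (x + y))\<^sup>2 \<le> (snorm x + snorm y)\<^sup>2" .
qed (simp add: snorm_nonneg)

lemma snorm_le_norm: "\<exists>c\<ge>0. \<forall>x. snorm x \<le> c * norm x"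
proof -
  obtain K where K: "K > 0" "\<And>x. norm (A x) \<le> norm x * K" using pos_bounded by blast
  have "snorm x \<le> sqrt K * norm x" for x
  proof -
    have "form x x \<le> norm x * K * norm x"
      by (meson K(2) mult_right_mono norm_cauchy_schwarz norm_ge_zero order_trans)
    then have "snorm x \<le> sqrt (K * (norm x)\<^sup>2)"
      unfolding snorm_def by (simp add: power2_eq_square mult_ac)
    then show ?thesis by (simp add: real_sqrt_mult)
  qed
  then show ?thesis using K(1) by (intro exI[of _ "sqrt K"]) simp
qed

text \<open>Boundedness refers to the norm only; boundedness for \<open>snorm\<close> is then a
  consequence, \<open>form_symmetric_bounded\<close>.\<close>

definition form_symmetric :: "('a \<Rightarrow> 'a) \<Rightarrow> bool" where
  "form_symmetric S \<longleftrightarrow> bounded_linear S \<and> (\<forall>x y. form (S x) y = form x (S y))"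

lemma form_symmetric_funpow:
  assumes "form_symmetric S"
  shows "form ((S ^^ k) x) y = form x ((S ^^ k) y)"
  using assms by (induction k arbitrary: x y) (auto simp: form_symmetric_def funpow_swap1)

text \<open>
  Krein's theorem. Iterating \<open>snorm (S x)\<^sup>2 = form (S (S x)) x \<le> snorm (S (S x))\<close> for
  \<open>snorm x = 1\<close> bounds \<open>snorm (S x)\<close> to the power \<open>2\<^sup>n\<close> by a multiple of
  the same power of the norm of \<open>S\<close>.
\<close>
lemma form_symmetric_bounded:
  assumes S: "form_symmetric S"
  shows "\<exists>K\<ge>0. \<forall>x. snorm (S x) \<le> K * snorm x"
proof -
  interpret S: bounded_linear S using S by (simp add: form_symmetric_def)
  obtain K where K: "K > 0" "\<And>x. norm (S x) \<le> norm x * K" using S.pos_bounded by blast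
  obtain c where c: "c \<ge> 0" "\<And>x. snorm x \<le> c * norm x" using snorm_le_norm by blast
  have doubling: "(snorm ((S ^^ k) x))\<^sup>2 \<le> snorm ((S ^^ (2 * k)) x) * snorm x" for k x
  proof -
    have "(snorm ((S ^^ k) x))\<^sup>2 = form ((S ^^ (2 * k)) x) x"
      by (simp add: snorm_sq form_symmetric_funpow[OF S] mult_2 funpow_add)
    then show ?thesis using form_le[of "(S ^^ (2 * k)) x" x] by linarith
  qed
  have unit: "snorm (S x) \<le> K" if x: "snorm x = 1" for x
  proof (rule ccontr)
    assume "\<not> ?thesis"
    then have q: "snorm (S x) / K > 1" using K(1) by simp
    have "(snorm (S x)) ^ (2 ^ n) \<le> snorm ((S ^^ (2 ^ n)) x)" for n
    proof (induction n)
      case (Suc n)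
      have "(snorm (S x)) ^ (2 ^ Suc n) = ((snorm (S x)) ^ (2 ^ n))\<^sup>2"
        by (simp add: power_mult[symmetric] mult.commute)
      also have "\<dots> \<le> (snorm ((S ^^ (2 ^ n)) x))\<^sup>2"
        using Suc by (intro power_mono) (auto simp: snorm_nonneg)
      also have "\<dots> \<le> snorm ((S ^^ (2 ^ Suc n)) x)"
        using doubling[of "2 ^ n" x] x by simp
      finally show ?case .
    qed simp
    moreover have "norm ((S ^^ k) x) \<le> norm x * K ^ k" for k
    proof (induction k)
      case (Suc k)
      have "norm ((S ^^ Suc k) x) \<le> norm ((S ^^ k) x) * K" using K(2) by simp
      also have "\<dots> \<le> norm x * K ^ k * K" using Suc K(1) by (intro mult_right_mono) auto
      finally show ?case by (simp add: mult_ac)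
    qed simp
    ultimately have le: "(snorm (S x)) ^ (2 ^ n) \<le> c * (norm x * K ^ (2 ^ n))" for n
      using c by (meson mult_left_mono order_trans)
    have "(snorm (S x) / K) ^ (2 ^ n) \<le> c * norm x" for n
      using le[of n] K(1) by (simp add: power_divide divide_simps mult_ac)
    moreover obtain m where m: "c * norm x < (snorm (S x) / K) ^ m"
      using real_arch_pow[OF q] by blast
    \<comment> \<open>The upper bound is known for exponents \<open>2 ^ n\<close> only;
      \<open>m \<le> 2 ^ m\<close> carries the geometric growth over to them.\<close>
    moreover have "(snorm (S x) / K) ^ m \<le> (snorm (S x) / K) ^ (2 ^ m)"
      using q by (intro power_increasing) (auto intro: less_imp_le)
    ultimately show False by (meson not_le order_trans)
  qed
  have "snorm (S x) \<le> K * snorm x" for x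
  proof (cases "snorm x = 0")
    case True
    \<comment> \<open>Null vectors of the seminorm cannot be normalised, but doubling with
      \<open>k = 1\<close> shows that \<open>S\<close> keeps them null.\<close>
    then show ?thesis using doubling[of 1 x] by simp
  next
    case False
    then have "snorm x > 0" using snorm_nonneg[of x] by simp
    then show ?thesis
      using unit[of "(1 / snorm x) *\<^sub>R x"] by (simp add: snorm_scale S.scale field_simps)
  qed
  then show ?thesis using K(1) by (intro exI[of _ K]) simp
qed

text \<open>Polarisation and the parallelogram law bound \<open>form (S u) v\<close> by the
  quadratic form; testing against a multiple of \<open>S x\<close> recovers
  \<open>snorm (S x)\<close>.\<close>

lemma form_symmetric_numerical_range:
  assumes S: "form_symmetric S"
    and k: "\<And>x. \<bar>form (S x) x\<bar> \<le> k * form x x"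
  shows "snorm (S x) \<le> k * snorm x"
proof -
  interpret S: bounded_linear S using S by (simp add: form_symmetric_def)
  have symS: "form (S u) v = form u (S v)" for u v using S by (simp add: form_symmetric_def)
  have polar: "2 * form (S u) v \<le> k * ((snorm u)\<^sup>2 + (snorm v)\<^sup>2)" for u v
  proof -
    have "4 * form (S u) v = form (S (u + v)) (u + v) - form (S (u - v)) (u - v)"
      using symS[of v u] form_commute[of v "S u"]
      by (simp add: S.add S.diff add diff inner_add_left inner_add_right inner_diff_left inner_diff_right)
    also have "\<dots> \<le> k * form (u + v) (u + v) + k * form (u - v) (u - v)"
      using k[of "u + v"] k[of "u - v"] by linarith
    also have "\<dots> = 2 * k * ((snorm u)\<^sup>2 + (snorm v)\<^sup>2)"
      by (simp add: snorm_sq add diff inner_add_left inner_add_right inner_diff_left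
          inner_diff_right algebra_simps)
    finally show ?thesis by simp
  qed
  show ?thesis
  proof (cases "snorm x = 0")
    case True
    then have "(snorm (S x))\<^sup>2 \<le> 0"
      using form_le[of x "S (S x)"] by (simp add: snorm_sq symS)
    then show ?thesis using True by simp
  next
    case False
    show ?thesis
    proof (cases "snorm (S x) = 0")
      case True
      have "k * form x x \<ge> 0" using k[of x] by linarith
      moreover have "form x x > 0" using False snorm_sq[of x] nonneg[of x] by (metis less_eq_real_def power_zero_numeral zero_eq_power2)
      ultimately have "k \<ge> 0" by (simp add: zero_le_mult_iff)
      with True show ?thesis by (simp add: snorm_nonneg)
    next
      case nz: False
      \<comment> \<open>This scaling gives \<open>t *\<^sub>R S x\<close> the seminorm of
        \<open>x\<close>, so that the sum of squares in \<open>polar\<close> is twice the product of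
        the seminorms.\<close>
      define t where "t = snorm x / snorm (S x)"
      have pos: "snorm x > 0" "snorm (S x) > 0"
        using False nz snorm_nonneg by (simp_all add: less_le)
      have "snorm (t *\<^sub>R S x) = snorm x" using pos by (simp add: t_def snorm_scale)
      moreover have "form (S x) (t *\<^sub>R S x) = snorm x * snorm (S x)"
        using pos by (simp add: t_def power2_eq_square flip: snorm_sq)
      ultimately have "snorm x * snorm (S x) \<le> snorm x * (k * snorm x)"
        using polar[of x "t *\<^sub>R S x"] by (simp add: power2_eq_square mult_ac)
      then show ?thesis using pos by simp
    qed
  qed
qed

end

subsection \<open>Adjoints in complex Hilbert spaces\<close>

lemma cinner_add_right: "cinner x (y + z) = cinner x y + cinner x z"
  for x :: "'a::complex_inner"
  by (metis cinner_commute cinner_add_left complex_cnj_add)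

lemma cinner_scaleC_right: "cinner x (c *\<^sub>C y) = cnj c * cinner x y"
  for x :: "'a::complex_inner"
  by (metis cinner_commute cinner_scaleC_left complex_cnj_mult)

text \<open>The scalar \<i> leaves the conjugate-linear slot as \<open>-\<i>\<close>, which turns
  the imaginary part into a real part.\<close>

lemma Im_cinner: "Im (cinner x y) = inner x (\<i> *\<^sub>C y)"
  for x :: "'a::complex_inner"
  by (simp add: inner_eq_Re_cinner cinner_scaleC_right)

lemma norm_scaleC: "norm (c *\<^sub>C x) = cmod c * norm x"
  for x :: "'a::complex_inner"
proof (rule power2_eq_imp_eq)
  have "(norm (c *\<^sub>C x))\<^sup>2 = Re (c * cnj c * cinner x x)"
    by (simp add: power2_norm_eq_inner inner_eq_Re_cinner cinner_scaleC_left
        cinner_scaleC_right mult_ac)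
  also have "c * cnj c = complex_of_real ((cmod c)\<^sup>2)"
    by (rule complex_norm_square[symmetric])
  finally show "(norm (c *\<^sub>C x))\<^sup>2 = (cmod c * norm x)\<^sup>2"
    by (simp add: power_mult_distrib power2_norm_eq_inner inner_eq_Re_cinner flip: of_real_power)
qed auto

lemma bounded_linear_scaleC: "bounded_linear (\<lambda>x::'a::complex_inner. c *\<^sub>C x)"
  by (rule bounded_linear_intro[where K = "cmod c"])
    (simp_all add: scaleC_add_right norm_scaleC scaleR_eq_scaleC scaleC_scaleC mult.commute)

text \<open>The adjoint for the real inner product is already the complex one: replacing
  \<open>x\<close> by \<open>\<i> *\<^sub>C x\<close> yields the imaginary parts. Nondegeneracy
  gives complex linearity and the uniqueness behind \<open>adj\<close>.\<close>

lemma bounded_op_adjoint: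
  fixes T :: "'a::complex_hilbert \<Rightarrow> 'a"
  assumes T: "bounded_op T"
  shows "bounded_op (adj T)" and "cinner (T x) y = cinner x (adj T y)"
proof -
  have Tc: "T (c *\<^sub>C x) = c *\<^sub>C T x" for c x using T by (simp add: bounded_op_def)
  obtain S where S: "bounded_linear S" "\<And>x y. inner (T x) y = inner x (S y)"
    using adjoint_exists T unfolding bounded_op_def by blast
  have cS: "cinner (T x) y = cinner x (S y)" for x y
  proof (rule complex_eqI)
    show "Re (cinner (T x) y) = Re (cinner x (S y))"
      using S(2) by (simp add: inner_eq_Re_cinner)
    have "inner (T (\<i> *\<^sub>C x)) y = inner (\<i> *\<^sub>C x) (S y)" by (rule S(2))
    then show "Im (cinner (T x) y) = Im (cinner x (S y))"
      by (simp add: inner_eq_Re_cinner Tc cinner_scaleC_left)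
  qed
  have eqI: "u = v" if "\<And>x. cinner x u = cinner x v" for u v :: 'a
    using that vector_eq_ldot[of u v] by (simp add: inner_eq_Re_cinner)
  have "S (c *\<^sub>C x) = c *\<^sub>C S x" for c x
    by (rule eqI) (simp add: cinner_scaleC_right flip: cS)
  with S(1) have bS: "bounded_op S" by (simp add: bounded_op_def)
  have "adj T = S"
    unfolding adj_def
  proof (rule the_equality)
    fix S' assume S': "bounded_op S' \<and> (\<forall>x y. cinner (T x) y = cinner x (S' y))"
    show "S' = S"
    proof
      fix y
      show "S' y = S y" by (rule eqI) (metis S' cS)
    qed
  qed (use bS cS in blast)
  with bS cS show "bounded_op (adj T)" "cinner (T x) y = cinner x (adj T y)" by simp_all
qed

text \<open>Symmetry comes from polarisation: the value at \<open>x + \<i> *\<^sub>C y\<close> is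
  real, and its imaginary part is the difference of the two mixed real inner products.\<close>

lemma positive_op_psd:
  assumes "positive_op A"
  shows "psd_op A"
proof -
  have A: "bounded_linear A" and Ac: "\<And>c x. A (c *\<^sub>C x) = c *\<^sub>C A x"
    and pos: "\<And>x. cinner (A x) x \<in> \<real>\<^sub>\<ge>\<^sub>0"
    using assms by (auto simp: positive_op_def bounded_op_def)
  interpret bounded_linear A by fact
  have real: "Im (cinner (A x) x) = 0" for x
    using pos[of x] by (simp add: complex_nonneg_Reals_iff)
  have "inner (A x) y = inner x (A y)" for x y
    using real[of "x + \<i> *\<^sub>C y"] real[of x] real[of y]
    by (simp add: add Ac cinner_add_left cinner_add_right cinner_scaleC_left cinner_scaleC_right
        inner_commute[of x "A y"] inner_eq_Re_cinner[of "A _"])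
  moreover have "inner (A x) x \<ge> 0" for x
    using pos[of x] by (simp add: complex_nonneg_Reals_iff inner_eq_Re_cinner)
  ultimately show ?thesis by unfold_locales auto
qed

section \<open>Orthogonal splitting into the closed range and the kernel of a symmetric
  operator\<close>

context psd_op
begin

lemma subspace_closure_range: "subspace (closure (range A))"
  by (intro closure_of_subspace linear_subspace_image linear_axioms subspace_UNIV)

lemma orthogonal_range_imp_kernel:
  assumes "\<And>m. m \<in> closure (range A) \<Longrightarrow> inner z m = 0"
  shows "A z = 0"
proof -
  have "inner (A z) v = 0" for v
    using assms[of "A v"] closure_subset[of "range A"] by (auto simp: sym)
  then show ?thesis by (metis inner_eq_zero_iff)
qed

lemma kernel_imp_orthogonal_range:
  assumes "A z = 0" "m \<in> closure (range A)"
  shows "inner z m = 0"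
proof -
  have "closed {m. inner z m = 0}"
    by (intro closed_Collect_eq continuous_intros)
  moreover have "range A \<subseteq> {m. inner z m = 0}"
    using assms(1) by (auto simp flip: sym)
  ultimately show ?thesis using assms(2) closure_minimal by blast
qed

text \<open>A kernel vector in the closed range is orthogonal to itself. This is the source of the
  uniqueness of \<open>sharp_A\<close>.\<close>

lemma inj_on_closure_range: "inj_on A (closure (range A))"
proof (rule inj_onI)
  fix x y assume xy: "x \<in> closure (range A)" "y \<in> closure (range A)" "A x = A y"
  then have "inner (x - y) (x - y) = 0"
    by (intro kernel_imp_orthogonal_range subspace_diff subspace_closure_range) (auto simp: diff)
  then show "x = y" by simp
qed

end

text \<open>The error of projecting onto the closed range is orthogonal to the range, hence in the
  kernel.\<close>

lemma psd_op_decompose: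
  fixes A :: "'a::{real_inner, complete_space} \<Rightarrow> 'a"
  assumes "psd_op A"
  shows "\<exists>p z. x = p + z \<and> p \<in> closure (range A) \<and> A z = 0"
proof -
  interpret psd_op A by fact
  obtain p where p: "p \<in> closure (range A)" "\<forall>m\<in>closure (range A). inner (x - p) m = 0"
    using orthogonal_projection_exists[OF subspace_closure_range closed_closure] by blast
  then have "A (x - p) = 0" by (intro orthogonal_range_imp_kernel) auto
  with p(1) show ?thesis by (intro exI[of _ p] exI[of _ "x - p"]) simp
qed

text \<open>
  Douglas' factorization. Instead of the closed graph theorem, boundedness of \<open>X\<close> comes
  from the uniform boundedness of the vectors \<open>A (T y)\<close> with \<open>norm (A y) \<le> 1\<close>, since
  \<open>inner (X x) (A y) = inner x (A (T y))\<close>.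
\<close>
lemma sharp_A_properties:
  fixes A T :: "'a::complex_hilbert \<Rightarrow> 'a"
  assumes A: "positive_op A" and T: "T \<in> ops_A A"
  shows "bounded_op (sharp_A A T)" and "A (sharp_A A T x) = adj T (A x)"
proof -
  interpret psd_op A by (rule positive_op_psd[OF A])
  have Ac: "A (c *\<^sub>C x) = c *\<^sub>C A x" for c x
    using A by (simp add: positive_op_def bounded_op_def)
  have bT: "bounded_op T" and ran: "range (adj T \<circ> A) \<subseteq> range A"
    using T by (auto simp: ops_A_def)
  interpret S: bounded_linear "adj T"
    using bounded_op_adjoint(1)[OF bT] by (simp add: bounded_op_def)
  have Sc: "adj T (c *\<^sub>C x) = c *\<^sub>C adj T x" for c x
    using bounded_op_adjoint(1)[OF bT] by (simp add: bounded_op_def)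
  have adjT: "inner (T x) y = inner x (adj T y)" for x y
    by (simp add: inner_eq_Re_cinner bounded_op_adjoint(2)[OF bT])
  \<comment> \<open>Any preimage may be projected onto the closed range, since the part removed is
    killed by \<open>A\<close>.\<close>
  have "\<exists>p \<in> closure (range A). A p = adj T (A x)" for x
  proof -
    obtain u where "A u = adj T (A x)" using ran by (metis comp_apply imageE range_subsetD)
    moreover obtain p z where "u = p + z" "p \<in> closure (range A)" "A z = 0"
      using psd_op_decompose[OF psd_op_axioms] by blast
    ultimately show ?thesis by (auto simp: add intro!: bexI[of _ p])
  qed
  then obtain X where X: "\<And>x. X x \<in> closure (range A)" "\<And>x. A (X x) = adj T (A x)"
    by metis
  \<comment> \<open>Linearity and uniqueness of \<open>X\<close> reduce to identities after applying
    \<open>A\<close>.\<close>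
  have eqI: "u = v" if "u \<in> closure (range A)" "v \<in> closure (range A)" "A u = A v" for u v
    using inj_on_closure_range that by (auto dest: inj_onD)
  have scaleC_closed: "c *\<^sub>C u \<in> closure (range A)" if "u \<in> closure (range A)" for c u
  proof -
    have "(\<lambda>x. c *\<^sub>C x) ` closure (range A) \<subseteq> closure ((\<lambda>x. c *\<^sub>C x) ` range A)"
      by (intro closure_bounded_linear_image_subset bounded_linear_scaleC)
    also have "(\<lambda>x. c *\<^sub>C x) ` range A \<subseteq> range A" by (auto simp flip: Ac)
    then have "closure ((\<lambda>x. c *\<^sub>C x) ` range A) \<subseteq> closure (range A)" by (rule closure_mono)
    finally show ?thesis using that by blast
  qed
  define V where "V = {A (T y) |y. norm (A y) \<le> 1}"
  have XA: "inner x (A (T y)) = inner (X x) (A y)" for x y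
    using adjT[of y "A x"] by (metis X(2) inner_commute sym)
  have "bounded ((\<lambda>v. inner x v) ` V)" for x
    unfolding bounded_iff
  proof (intro exI ballI)
    fix r assume "r \<in> (\<lambda>v. inner x v) ` V"
    then obtain y where y: "norm (A y) \<le> 1" "r = inner x (A (T y))" by (auto simp: V_def)
    have "\<bar>r\<bar> \<le> norm (X x) * norm (A y)"
      unfolding y XA by (rule Cauchy_Schwarz_ineq2)
    also have "\<dots> \<le> norm (X x)" using y(1) by (simp add: mult_left_le)
    finally show "norm r \<le> norm (X x)" by simp
  qed
  then obtain C where C: "\<And>y. norm (A y) \<le> 1 \<Longrightarrow> norm (A (T y)) \<le> C"
    using weakly_bounded_imp_bounded[of V] unfolding bounded_iff V_def by blast
  have dense_bound: "inner (X x) (A y) \<le> norm x * C * norm (A y)" for x y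
  proof (cases "A y = 0")
    case False
    define y' where "y' = (1 / norm (A y)) *\<^sub>R y"
    have "norm (A y') \<le> 1" using False by (simp add: y'_def scale)
    then have "norm (A (T y')) \<le> C" by (rule C)
    then have "inner (X x) (A y') \<le> norm x * C"
      unfolding XA[symmetric]
      by (meson mult_left_mono norm_cauchy_schwarz norm_ge_zero order_trans)
    then show ?thesis using False by (simp add: y'_def scale field_simps)
  qed simp
  \<comment> \<open>Continuity extends the estimate from the range of \<open>A\<close> to its
    closure, which contains \<open>X x\<close> itself; the test vector is
    \<open>m = X x\<close>.\<close>
  have bound: "norm (X x) \<le> norm x * C" for x
  proof -
    have "closed {m. inner (X x) m \<le> norm x * C * norm m}"
      by (intro closed_Collect_le continuous_intros)
    moreover have "range A \<subseteq> {m. inner (X x) m \<le> norm x * C * norm m}"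
      using dense_bound by auto
    ultimately have "inner (X x) (X x) \<le> norm x * C * norm (X x)"
      using X(1) closure_minimal by blast
    then have "norm (X x) * norm (X x) \<le> norm x * C * norm (X x)"
      by (simp flip: power2_norm_eq_inner power2_eq_square)
    moreover have "C \<ge> 0" by (rule order_trans[OF norm_ge_zero C[of 0]]) (simp add: zero)
    ultimately show ?thesis by (cases "X x = 0") simp_all
  qed
  have bX: "bounded_op X"
    unfolding bounded_op_def
  proof (intro conjI allI)
    show "bounded_linear X"
    proof (rule bounded_linear_intro)
      show "X (x + y) = X x + X y" for x y
        by (rule eqI) (auto intro!: X subspace_add subspace_closure_range simp: X add S.add)
      show "X (r *\<^sub>R x) = r *\<^sub>R X x" for r x
        by (rule eqI) (auto intro!: X subspace_scale subspace_closure_range simp: X scale S.scale)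
    qed (rule bound)
    show "X (c *\<^sub>C x) = c *\<^sub>C X x" for c x
      by (rule eqI) (auto intro!: X scaleC_closed simp: X Ac Sc)
  qed
  have "sharp_A A T = X"
    unfolding sharp_A_def
  proof (rule the_equality)
    show "bounded_op X \<and> A \<circ> X = adj T \<circ> A \<and> range X \<subseteq> closure (range A)"
      using bX X by auto
  next
    fix Y assume Y: "bounded_op Y \<and> A \<circ> Y = adj T \<circ> A \<and> range Y \<subseteq> closure (range A)"
    show "Y = X"
    proof
      fix x
      have "A (Y x) = adj T (A x)" using Y by (metis comp_apply)
      moreover have "Y x \<in> closure (range A)" using Y by blast
      ultimately show "Y x = X x" by (simp add: eqI X)
    qed
  qed
  with bX X show "bounded_op (sharp_A A T)" "A (sharp_A A T x) = adj T (A x)" by simp_all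
qed

subsection \<open>Operator seminorms and the numerical radius\<close>

lemma norm_A_eq_snorm:
  assumes "positive_op A"
  shows "norm_A A x = psd_op.snorm A x"
  using psd_op.snorm_def[OF positive_op_psd[OF assms]]
  by (simp add: norm_A_def cinner_A_def inner_eq_Re_cinner)

lemma nonneg_Sup_upper:
  assumes "bdd_above S" "x \<in> S"
  shows "x \<le> nonneg_Sup S"
  using assms by (auto simp: nonneg_Sup_def intro: cSup_upper)

lemma nonneg_Sup_least:
  assumes "c \<ge> 0" "\<And>x. x \<in> S \<Longrightarrow> x \<le> c"
  shows "nonneg_Sup S \<le> c"
  using assms by (auto simp: nonneg_Sup_def intro: cSup_least)

lemma nonneg_Sup_nonneg:
  assumes "bdd_above S" "\<And>x. x \<in> S \<Longrightarrow> x \<ge> 0"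
  shows "nonneg_Sup S \<ge> 0"
proof (cases "S = {}")
  case False
  then obtain x where "x \<in> S" by blast
  then show ?thesis using assms nonneg_Sup_upper order_trans by blast
qed (simp add: nonneg_Sup_def)

lemma opnorm_A_le:
  assumes "c \<ge> 0" "\<And>x. norm_A A x = 1 \<Longrightarrow> norm_A A (S x) \<le> c"
  shows "opnorm_A A S \<le> c"
  unfolding opnorm_A_def using assms by (auto intro: nonneg_Sup_least)

text \<open>The supremum sees only the closed range. The kernel part \<open>z\<close> of
  \<open>x\<close> is null, and \<open>S\<close> keeps it null by Krein's bound, so it affects
  neither side. That bound also makes the supremum finite.\<close>

lemma norm_A_le_opnorm_A:
  fixes A S :: "'a::complex_hilbert \<Rightarrow> 'a"
  assumes A: "positive_op A" and S: "psd_op.form_symmetric A S"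
  shows "norm_A A (S x) \<le> opnorm_A A S * norm_A A x" and "opnorm_A A S \<ge> 0"
proof -
  interpret psd_op A by (rule positive_op_psd[OF A])
  interpret S: bounded_linear S using S by (simp add: form_symmetric_def)
  note eq = norm_A_eq_snorm[OF A]
  obtain K where K: "K \<ge> 0" "\<And>x. snorm (S x) \<le> K * snorm x"
    using form_symmetric_bounded[OF S] by blast
  let ?U = "{snorm (S x) |x. x \<in> closure (range A) \<and> snorm x = 1}"
  have U: "opnorm_A A S = nonneg_Sup ?U" by (simp add: opnorm_A_def eq)
  have bdd: "bdd_above ?U"
    using K by (intro bdd_aboveI[of _ K]) (auto, metis mult.right_neutral)
  then show "opnorm_A A S \<ge> 0"
    unfolding U by (rule nonneg_Sup_nonneg) (auto simp: snorm_nonneg)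
  obtain p z where pz: "x = p + z" "p \<in> closure (range A)" "A z = 0"
    using psd_op_decompose[OF psd_op_axioms] by blast
  have "snorm z = 0" by (simp add: snorm_def pz)
  then have "snorm (S z) = 0" using K(2)[of z] snorm_nonneg[of "S z"] by simp
  then have Sx: "snorm (S x) \<le> snorm (S p)"
    using snorm_triangle[of "S p" "S z"] by (simp add: pz S.add)
  have "form p z = 0" using sym[of p z] pz by simp
  then have x: "snorm x = snorm p"
    by (simp add: snorm_def pz add inner_add_right)
  have "snorm (S p) \<le> opnorm_A A S * snorm p"
  proof (cases "snorm p = 0")
    case True
    then show ?thesis using K(2)[of p] by simp
  next
    case False
    then have pos: "snorm p > 0" using snorm_nonneg[of p] by simp
    define q where "q = (1 / snorm p) *\<^sub>R p"
    have "q \<in> closure (range A)" "snorm q = 1"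
      using pos pz by (auto simp: q_def snorm_scale intro: subspace_scale subspace_closure_range)
    then have "snorm (S q) \<le> opnorm_A A S"
      unfolding U by (intro nonneg_Sup_upper[OF bdd]) blast
    then show ?thesis using pos by (simp add: q_def snorm_scale S.scale field_simps)
  qed
  with Sx show "norm_A A (S x) \<le> opnorm_A A S * norm_A A x" by (simp add: eq x)
qed

section \<open>The lower bound for the numerical radius\<close>

theorem theorem2p11:
  fixes A T :: "'a::complex_hilbert \<Rightarrow> 'a"
  assumes "positive_op A"
    and "T \<in> ops_A A"
  shows "numrad_A A T \<ge>
    sqrt (opnorm_A A (\<lambda>x. sharp_A A T (T x) + T (sharp_A A T x)) / 4
      + \<bar>(opnorm_A A (\<lambda>x. Re_A A T x + Im_A A T x))\<^sup>2
          - (opnorm_A A (\<lambda>x. Re_A A T x - Im_A A T x))\<^sup>2\<bar> / 4)"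
proof -
  interpret psd_op A by (rule positive_op_psd[OF assms(1)])
  note eq = norm_A_eq_snorm[OF assms(1)]
  define X where "X = sharp_A A T"
  \<comment> \<open>Multiplication by \<i> is treated as a real-linear skew map, so that all
    computations stay within the real form.\<close>
  define J where "J = (\<lambda>x::'a. \<i> *\<^sub>C x)"
  have bT: "bounded_op T" using assms by (simp add: ops_A_def)
  have bX: "bounded_op X" and AX: "\<And>x. A (X x) = adj T (A x)"
    using sharp_A_properties[OF assms] by (simp_all add: X_def)
  interpret T: bounded_linear T using bT by (simp add: bounded_op_def)
  interpret X: bounded_linear X using bX by (simp add: bounded_op_def)
  interpret J: bounded_linear J unfolding J_def by (rule bounded_linear_scaleC)
  have TJ: "T (J x) = J (T x)" and XJ: "X (J x) = J (X x)" and AJ: "A (J x) = J (A x)"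
    and JJ: "J (J x) = - x" for x
    using bT bX assms(1) scaleR_eq_scaleC[of "-1" x]
    by (simp_all add: J_def bounded_op_def positive_op_def scaleC_scaleC)
  have J_adj: "inner (J x) y = - inner x (J y)" for x y
    by (simp add: J_def inner_eq_Re_cinner cinner_scaleC_left cinner_scaleC_right)
  have T_adj: "form (T x) y = form x (X y)" for x y
  proof -
    have "form (T x) y = inner (T x) (A y)" by (rule sym)
    also have "\<dots> = inner x (adj T (A y))"
      by (simp add: inner_eq_Re_cinner bounded_op_adjoint(2)[OF bT])
    also have "\<dots> = form x (X y)" by (simp add: sym AX)
    finally show ?thesis .
  qed
  have X_adj: "form (X x) y = form x (T y)" for x y
    using T_adj[of y x] form_commute by metis
  have Re_A_eq: "Re_A A T x = (1 / 2) *\<^sub>R (T x + X x)" for x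
    by (simp add: Re_A_def X_def scaleR_eq_scaleC)
  \<comment> \<open>Here \<open>1 / (2 * \<i>) = - \<i> / 2\<close>.\<close>
  have Im_A_eq: "Im_A A T x = (- 1 / 2) *\<^sub>R J (T x - X x)" for x
    by (simp add: Im_A_def X_def J_def scaleR_eq_scaleC scaleC_scaleC)
  define P where "P = (\<lambda>x. Re_A A T x + Im_A A T x)"
  define M where "M = (\<lambda>x. Re_A A T x - Im_A A T x)"
  have re_sym: "form_symmetric (Re_A A T)"
    unfolding form_symmetric_def Re_A_eq[abs_def]
    by (auto intro!: bounded_linear_intros T.bounded_linear_axioms X.bounded_linear_axioms
        simp: scale add inner_add_left inner_add_right T_adj X_adj)
  have "bounded_linear (\<lambda>x. (- 1 / 2) *\<^sub>R J (T x - X x))"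
    by (intro bounded_linear_compose[OF bounded_linear_scaleR_right]
        bounded_linear_compose[OF J.bounded_linear_axioms] bounded_linear_sub
        T.bounded_linear_axioms X.bounded_linear_axioms)
  moreover have "form ((- 1 / 2) *\<^sub>R J (T x - X x)) y = form x ((- 1 / 2) *\<^sub>R J (T y - X y))" for x y
  proof -
    \<comment> \<open>Two signs cancel: \<open>J\<close> is skew, and passing to form adjoints
      exchanges \<open>T\<close> and \<open>X\<close>.\<close>
    have "form ((- 1 / 2) *\<^sub>R J (T x - X x)) y = (1 / 2) * (form x (X (J y)) - form x (T (J y)))"
      unfolding scale AJ inner_scaleR_left J_adj diff inner_diff_left T_adj X_adj by (simp add: field_simps)
    also have "\<dots> = form x ((- 1 / 2) *\<^sub>R J (T y - X y))"
      unfolding inner_scaleR_right J.diff inner_diff_right TJ XJ by (simp add: field_simps)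
    finally show ?thesis .
  qed
  ultimately have im_sym: "form_symmetric (Im_A A T)"
    unfolding form_symmetric_def Im_A_eq[abs_def] by blast
  from re_sym im_sym have symP: "form_symmetric P" and symM: "form_symmetric M"
    unfolding form_symmetric_def P_def M_def
    by (auto intro!: bounded_linear_add bounded_linear_sub
        simp: add diff inner_add_left inner_add_right inner_diff_left inner_diff_right)
  have PM: "P (P x) + M (M x) = X (T x) + T (X x)" for x
  proof -
    \<comment> \<open>Doubling both operators clears the fractions; the mixed products of real and
      imaginary part cancel in the sum of squares.\<close>
    define P' M' where "P' x = T x + X x - J (T x) + J (X x)"
      and "M' x = T x + X x + J (T x) - J (X x)" for x
    have half: "P x = (1 / 2) *\<^sub>R P' x" "M x = (1 / 2) *\<^sub>R M' x" for x
      unfolding P_def M_def P'_def M'_def Re_A_eq Im_A_eq J.diff by (simp_all add: algebra_simps)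
    have "P' (c *\<^sub>R x) = c *\<^sub>R P' x" "M' (c *\<^sub>R x) = c *\<^sub>R M' x" for c x
      by (simp_all add: P'_def M'_def T.scale X.scale J.scale algebra_simps)
    then have "P (P x) + M (M x) = (1 / 4) *\<^sub>R (P' (P' x) + M' (M' x))"
      by (simp add: half algebra_simps)
    also have "P' (P' x) + M' (M' x) = 4 *\<^sub>R (X (T x) + T (X x))"
    proof -
      have four: "4 *\<^sub>R v = v + v + v + v" for v :: 'a
        using scaleR_left_distrib[of 2 2 v] by (simp add: scaleR_2 add.assoc)
      show ?thesis
        unfolding four P'_def M'_def
        by (simp add: T.add T.diff X.add X.diff J.add J.diff TJ XJ JJ algebra_simps)
    qed
    finally show ?thesis by simp
  qed
  have num: "cinner_A A (T x) x = Complex (form (Re_A A T x) x) (form (Im_A A T x) x)" for x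
  proof (rule complex_eqI)
    have "form (X x) x = form (T x) x" using X_adj[of x x] form_commute by metis
    then show "Re (cinner_A A (T x) x) = Re (Complex (form (Re_A A T x) x) (form (Im_A A T x) x))"
      by (simp add: cinner_A_def inner_eq_Re_cinner[symmetric] Re_A_eq scale add inner_add_left)
    \<comment> \<open>The terms of \<open>T\<close> and of \<open>- X\<close> contribute equally to
      the imaginary part, which absorbs the factor one half.\<close>
    have "form (X x) (J x) = form x (J (T x))" by (simp add: X_adj TJ)
    also have "\<dots> = - form (J x) (T x)" by (simp add: AJ J_adj)
    also have "\<dots> = - form (T x) (J x)" by (simp add: form_commute)
    finally have "form (X x) (J x) = - form (T x) (J x)" .
    then have "form (Im_A A T x) x = form (T x) (J x)"
      unfolding Im_A_eq scale AJ inner_scaleR_left J_adj diff inner_diff_left by simp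
    then show "Im (cinner_A A (T x) x) = Im (Complex (form (Re_A A T x) x) (form (Im_A A T x) x))"
      by (simp add: cinner_A_def Im_cinner J_def)
  qed

  define w where "w = numrad_A A T"
  obtain K L where K: "K \<ge> 0" "\<And>x. snorm (Re_A A T x) \<le> K * snorm x"
    and L: "L \<ge> 0" "\<And>x. snorm (Im_A A T x) \<le> L * snorm x"
    using form_symmetric_bounded[OF re_sym] form_symmetric_bounded[OF im_sym] by metis
  let ?N = "{cmod (cinner_A A (T x) x) |x. snorm x = 1}"
  have w_eq: "w = nonneg_Sup ?N" by (simp add: w_def numrad_A_def eq)
  \<comment> \<open>This crude bound serves to make the supremum finite and to handle null vectors,
    which cannot be normalised.\<close>
  have num_le: "cmod (cinner_A A (T x) x) \<le> (K + L) * (snorm x)\<^sup>2" for x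
  proof -
    have "cmod (cinner_A A (T x) x) \<le> \<bar>form (Re_A A T x) x\<bar> + \<bar>form (Im_A A T x) x\<bar>"
      unfolding num using cmod_le[of "Complex _ _"] by simp
    also have "\<dots> \<le> snorm (Re_A A T x) * snorm x + snorm (Im_A A T x) * snorm x"
      by (intro add_mono form_le)
    also have "\<dots> \<le> K * snorm x * snorm x + L * snorm x * snorm x"
      by (intro add_mono mult_right_mono K L snorm_nonneg)
    finally show ?thesis by (simp add: power2_eq_square algebra_simps)
  qed
  then have bdd: "bdd_above ?N"
    by (intro bdd_aboveI[of _ "K + L"]) (clarsimp, metis mult.right_neutral power_one)
  have w0: "w \<ge> 0" unfolding w_eq using bdd by (rule nonneg_Sup_nonneg) auto
  have num_w: "cmod (cinner_A A (T x) x) \<le> w * form x x" for x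
  proof (cases "snorm x = 0")
    case True
    then show ?thesis using num_le[of x] w0 nonneg[of x] by (simp flip: snorm_sq)
  next
    case False
    then have pos: "snorm x > 0" using snorm_nonneg[of x] by simp
    define y where "y = (1 / snorm x) *\<^sub>R x"
    have "snorm y = 1" using pos by (simp add: y_def snorm_scale)
    then have "cmod (cinner_A A (T y) y) \<le> w"
      unfolding w_eq by (intro nonneg_Sup_upper[OF bdd]) blast
    moreover have "cinner_A A (T y) y = complex_of_real (1 / (snorm x)\<^sup>2) * cinner_A A (T x) x"
      unfolding y_def cinner_A_def T.scale scale
      by (simp add: scaleR_eq_scaleC cinner_scaleC_left cinner_scaleC_right power2_eq_square)
    ultimately have "cmod (cinner_A A (T x) x) / (snorm x)\<^sup>2 \<le> w"
      by (simp add: norm_mult norm_divide norm_power)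
    then show ?thesis
      using pos by (simp add: pos_divide_le_eq flip: snorm_sq)
  qed
  have PM_num: "\<bar>form (P x) x\<bar> \<le> sqrt 2 * w * form x x" "\<bar>form (M x) x\<bar> \<le> sqrt 2 * w * form x x"
    for x
  proof -
    define a b where "a = form (Re_A A T x) x" and "b = form (Im_A A T x) x"
    \<comment> \<open>The factor \<open>sqrt 2\<close> arises here; the left side dominates both
      \<open>\<bar>a + b\<bar>\<close> and \<open>\<bar>a - b\<bar>\<close>.\<close>
    have "\<bar>a\<bar> + \<bar>b\<bar> \<le> sqrt 2 * cmod (Complex a b)"
      using complex_abs_le_norm[of "Complex a b"] by simp
    also have "\<dots> \<le> sqrt 2 * (w * form x x)"
      using num_w[of x] by (simp add: num a_def b_def)
    finally have "\<bar>a\<bar> + \<bar>b\<bar> \<le> sqrt 2 * w * form x x" by (simp add: mult.assoc)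
    then show "\<bar>form (P x) x\<bar> \<le> sqrt 2 * w * form x x" "\<bar>form (M x) x\<bar> \<le> sqrt 2 * w * form x x"
      by (simp_all add: P_def M_def add diff inner_add_left inner_diff_left flip: a_def b_def)
  qed
  have opnorm_w: "(opnorm_A A S)\<^sup>2 \<le> 2 * w\<^sup>2"
    if "form_symmetric S" "\<And>x. \<bar>form (S x) x\<bar> \<le> sqrt 2 * w * form x x" for S
  proof -
    have "opnorm_A A S \<le> sqrt 2 * w"
      using form_symmetric_numerical_range[OF that] w0
      by (intro opnorm_A_le) (auto simp: eq, metis mult.right_neutral)
    then have "(opnorm_A A S)\<^sup>2 \<le> (sqrt 2 * w)\<^sup>2"
      using norm_A_le_opnorm_A(2)[OF assms(1) that(1)] by (intro power_mono)
    then show ?thesis by (simp add: power_mult_distrib)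
  qed
  define a b where "a = opnorm_A A P" and "b = opnorm_A A M"
  have ab: "a\<^sup>2 \<le> 2 * w\<^sup>2" "b\<^sup>2 \<le> 2 * w\<^sup>2"
    unfolding a_def b_def by (intro opnorm_w symP symM PM_num)+
  have square: "snorm (S (S x)) \<le> (opnorm_A A S)\<^sup>2" if S: "form_symmetric S" and x: "snorm x = 1" for S x
  proof -
    have "snorm (S (S x)) \<le> opnorm_A A S * snorm (S x)"
      using norm_A_le_opnorm_A(1)[OF assms(1) S] by (simp add: eq)
    also have "\<dots> \<le> opnorm_A A S * opnorm_A A S"
      using norm_A_le_opnorm_A[OF assms(1) S] x by (intro mult_left_mono) (auto simp: eq, metis mult.right_neutral)
    finally show ?thesis by (simp add: power2_eq_square)
  qed
  have "opnorm_A A (\<lambda>x. X (T x) + T (X x)) \<le> a\<^sup>2 + b\<^sup>2"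
  proof (rule opnorm_A_le)
    fix x assume "norm_A A x = 1"
    then have "snorm (P (P x)) \<le> a\<^sup>2" "snorm (M (M x)) \<le> b\<^sup>2"
      unfolding a_def b_def by (simp_all add: square symP symM eq)
    then show "norm_A A (X (T x) + T (X x)) \<le> a\<^sup>2 + b\<^sup>2"
      using snorm_triangle[of "P (P x)" "M (M x)"] by (simp add: eq flip: PM)
  qed simp
  \<comment> \<open>Each sign of the difference leaves twice one of the squares, at most
    \<open>4 * w\<^sup>2\<close>.\<close>
  moreover have "\<bar>a\<^sup>2 - b\<^sup>2\<bar> \<le> 4 * w\<^sup>2 - (a\<^sup>2 + b\<^sup>2)"
    using ab by (auto simp: abs_le_iff)
  ultimately have "opnorm_A A (\<lambda>x. X (T x) + T (X x)) / 4 + \<bar>a\<^sup>2 - b\<^sup>2\<bar> / 4 \<le> w\<^sup>2"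
    by simp
  then have "sqrt (opnorm_A A (\<lambda>x. X (T x) + T (X x)) / 4 + \<bar>a\<^sup>2 - b\<^sup>2\<bar> / 4) \<le> w"
    by (rule real_le_lsqrt[OF w0])
  then show ?thesis
    unfolding w_def a_def b_def X_def P_def M_def .
qed

end
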